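(* Let $m \ge 3$ be an integer and let $G$ be a $K_{1,m}$-free graph of order $n$ with minimum degree $\delta$. Then \[ \Gamma_d(G) < \frac{2(m-1)\, n \ln(\delta + m - 1)}{\delta + m - 1}. \]
   Context: $K_{1,m}$-free means $G$ has no induced subgraph isomorphic to the star $K_{1,m}$. $\ln$ is the natural logarithm. For a digraph $D$, a directed dominating set is a set $S \subseteq V(D)$ such that every vertex $u \notin S$ has a vertex $v \in S$ with arc $(v,u)$; $\gamma(D)$ is the minimum size of such a set. For a graph $G$, $\Gamma_d(G) = \max\{\gamma(D) : D \text{ an orientation of } G\}$. *)

theory Defs
  imports Complex_Main "Graph_Theory.Kuratowski"
begin

text \<open>
  A finite simple graph is a \<^locale>\<open>graph\<close> of the library, that is, a finite symmetric digraph
  without loops or multiple arcs. Each undirected edge is a pair of opposite arcs, so the degree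
  of a vertex is its out-degree.
\<close>

definition min_degree :: "('a, 'b) pre_digraph \<Rightarrow> nat" where
  "min_degree G = Min (out_degree G ` verts G)"

definition star_free :: "nat \<Rightarrow> ('a, 'b) pre_digraph \<Rightarrow> bool" where
  "star_free m G \<longleftrightarrow> \<not> (\<exists>H. induced_subgraph H G \<and> complete_bipartite_digraph 1 m H)"

text \<open>An orientation keeps exactly one of the two opposite arcs of every edge.\<close>

definition orientation :: "('a, 'b) pre_digraph \<Rightarrow> ('a, 'b) pre_digraph \<Rightarrow> bool" where
  "orientation D G \<longleftrightarrow> spanning D G \<and>
     (\<forall>u v. u \<rightarrow>\<^bsub>G\<^esub> v \<longrightarrow> (u \<rightarrow>\<^bsub>D\<^esub> v \<longleftrightarrow> \<not> v \<rightarrow>\<^bsub>D\<^esub> u))"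

definition dir_dominating :: "('a, 'b) pre_digraph \<Rightarrow> 'a set \<Rightarrow> bool" where
  "dir_dominating D S \<longleftrightarrow> S \<subseteq> verts D \<and> (\<forall>u \<in> verts D - S. \<exists>v \<in> S. v \<rightarrow>\<^bsub>D\<^esub> u)"

definition dir_domination_number :: "('a, 'b) pre_digraph \<Rightarrow> nat" where
  "dir_domination_number D = Min (card ` {S. dir_dominating D S})"

definition upper_dir_domination_number :: "('a, 'b) pre_digraph \<Rightarrow> nat" where
  "upper_dir_domination_number G = Max (dir_domination_number ` {D. orientation D G})"

text \<open>The sets under Min and Max are finite and nonempty, so these are genuine extrema.\<close>

lemma finite_dir_dominating:
  assumes "finite (verts D)" shows "finite {S. dir_dominating D S}"
  by (rule finite_subset[of _ "Pow (verts D)"]) (auto simp: dir_dominating_def assms)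

lemma dir_dominating_verts: "dir_dominating D (verts D)"
  by (simp add: dir_dominating_def)

lemma finite_orientations:
  assumes "fin_digraph G" shows "finite {D. orientation D G}"
proof -
  interpret fin_digraph G by fact
  have "{D. orientation D G} \<subseteq>
      (\<lambda>A. \<lparr>verts = verts G, arcs = A, tail = tail G, head = head G\<rparr>) ` Pow (arcs G)"
  proof
    fix D assume "D \<in> {D. orientation D G}"
    then have "arcs D \<subseteq> arcs G"
      "D = \<lparr>verts = verts G, arcs = arcs D, tail = tail G, head = head G\<rparr>"
      by (auto simp: orientation_def spanning_def subgraph_def compatible_def)
    then show "D \<in> (\<lambda>A. \<lparr>verts = verts G, arcs = A, tail = tail G, head = head G\<rparr>) ` Pow (arcs G)"
      by blast
  qed
  then show ?thesis by (rule finite_subset) simp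
qed

lemma orientation_exists:
  assumes "graph G" shows "\<exists>D. orientation D G"
proof -
  interpret graph G by fact
  obtain f :: "'a \<Rightarrow> nat" where f: "inj_on f (verts G)"
    using finite_imp_inj_to_nat_seg[OF finite_verts] by blast
  define D where "D = \<lparr>verts = verts G, arcs = {e \<in> arcs G. f (tail G e) < f (head G e)},
    tail = tail G, head = head G\<rparr>"
  have D: "u \<rightarrow>\<^bsub>D\<^esub> v \<longleftrightarrow> u \<rightarrow>\<^bsub>G\<^esub> v \<and> f u < f v" for u v
    by (auto simp: D_def arcs_ends_conv)
  have "(u \<rightarrow>\<^bsub>D\<^esub> v \<longleftrightarrow> \<not> v \<rightarrow>\<^bsub>D\<^esub> u)" if "u \<rightarrow>\<^bsub>G\<^esub> v" for u v
  proof -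
    have "u \<noteq> v" using that adj_not_same by blast
    then have "f u \<noteq> f v" using f that adj_in_verts by (meson inj_onD)
    then show ?thesis using that graph_symmetric[OF that] by (auto simp: D)
  qed
  moreover have "spanning D G"
    using wf_digraph by (auto simp: D_def spanning_def subgraph_def compatible_def wf_digraph_def)
  ultimately show ?thesis unfolding orientation_def by blast
qed

end

theory Submission
  imports Defs
begin

text \<open>
  If every independent set has at most \<open>\<alpha>\<close> vertices, the Caro--Wei bound forces every set of \<open>t\<close>
  vertices to have average degree at least \<open>t / \<alpha> - 1\<close>, so in any orientation some vertex of the set
  dominates at least \<open>(t / \<alpha> + 1) / 2\<close> of its members, itself included. Removing such vertices
  with everything they dominate multiplies \<open>t + \<alpha>\<close> by at most \<open>1 - 1 / (2 \<alpha>)\<close> per step, which gives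
  a directed dominating set of size at most \<open>2 \<alpha> ln (1 + n / \<alpha>)\<close>. In a graph without induced
  \<open>K\<^bsub>1,m\<^esub>\<close> a vertex outside an independent set has at most \<open>m - 1\<close> neighbours in it, and counting
  the edges leaving the set allows \<open>\<alpha> = (m - 1) n / (\<delta> + m - 1)\<close>. For \<open>\<delta> = 0\<close> this argument
  gives no strict inequality when \<open>m = 3\<close>, but then the trivial bound \<open>n\<close> suffices.
\<close>

section \<open>Independent sets and the Caro--Wei bound\<close>

text \<open>Taking a bare relation instead of a digraph lets the inductions below pass to vertex
  subsets without forming induced subgraphs.\<close>

definition indep :: "('a \<Rightarrow> 'a \<Rightarrow> bool) \<Rightarrow> 'a set \<Rightarrow> bool" where
  "indep E I \<longleftrightarrow> (\<forall>u\<in>I. \<forall>v\<in>I. \<not> E u v)"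

text \<open>Greedy choice: take \<open>v\<close> of minimum degree in \<open>A\<close> and delete
  its closed neighbourhood \<open>N\<close>. Each of the \<open>d A v + 1\<close> vertices of
  \<open>N\<close> contributes at most \<open>1 / (d A v + 1)\<close>, so the sum loses at most 1
  while the independent set gains \<open>v\<close>. Degrees only drop in the rest, so the remaining
  terms only grow.\<close>

lemma caro_wei:
  assumes "finite A" and "symp E" and "irreflp E"
  shows "\<exists>I\<subseteq>A. indep E I \<and> (\<Sum>v\<in>A. 1 / (real (card {u\<in>A. E v u}) + 1)) \<le> real (card I)"
  using assms(1)
proof (induction A rule: finite_psubset_induct)
  case (psubset A)
  show ?case
  proof (cases "A = {}")
    case True
    then show ?thesis by (auto simp: indep_def)
  next
    case False
    define d where "d X v = card {u\<in>X. E v u}" for X v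
    obtain v where v: "v \<in> A" "\<And>w. w \<in> A \<Longrightarrow> d A v \<le> d A w"
      using False psubset.hyps(1) by (metis arg_min_if_finite(1) arg_min_least)
    define N where "N = insert v {u\<in>A. E v u}"
    define B where "B = A - N"
    have N: "N \<subseteq> A" "finite N" "card N = d A v + 1"
      using v(1) psubset.hyps(1) \<open>irreflp E\<close> by (auto simp: N_def d_def irreflp_def)
    have "B \<subset> A" using v(1) by (auto simp: B_def N_def)
    from psubset.IH[OF this] obtain I where I: "I \<subseteq> B" "indep E I"
      "(\<Sum>w\<in>B. 1 / (real (d B w) + 1)) \<le> real (card I)" unfolding d_def by blast
    have "finite I" using I(1) \<open>B \<subset> A\<close> psubset.hyps(1) by (meson finite_subset psubset_imp_subset)
    have "v \<notin> I" using I(1) by (auto simp: B_def N_def)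
    have indep: "indep E (insert v I)"
      using I(1,2) assms(2,3) by (auto simp: indep_def B_def N_def irreflp_def dest: sympD)
    have "(\<Sum>w\<in>N. 1 / (real (d A w) + 1)) \<le> (\<Sum>w\<in>N. 1 / (real (d A v) + 1))"
      using v(2) N(1) by (intro sum_mono divide_left_mono) auto
    also have "\<dots> = 1" using N(3) by simp
    finally have sN: "(\<Sum>w\<in>N. 1 / (real (d A w) + 1)) \<le> 1" .
    have "d B w \<le> d A w" for w
      unfolding d_def using psubset.hyps(1) \<open>B \<subset> A\<close> by (intro card_mono) auto
    then have sB: "(\<Sum>w\<in>B. 1 / (real (d A w) + 1)) \<le> (\<Sum>w\<in>B. 1 / (real (d B w) + 1))"
      by (intro sum_mono divide_left_mono) auto
    have "(\<Sum>w\<in>A. 1 / (real (d A w) + 1))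
        = (\<Sum>w\<in>B. 1 / (real (d A w) + 1)) + (\<Sum>w\<in>N. 1 / (real (d A w) + 1))"
      unfolding B_def using N(1) psubset.hyps(1) by (intro sum.subset_diff) auto
    also have "\<dots> \<le> real (card (insert v I))"
      using sN sB I(3) \<open>finite I\<close> \<open>v \<notin> I\<close> by simp
    finally show ?thesis
      using indep I(1) v(1) \<open>B \<subset> A\<close> unfolding d_def by (intro exI[of _ "insert v I"]) auto
  qed
qed

section \<open>Greedy domination in an orientation\<close>

text \<open>Degrees inside \<open>A\<close> sum to twice the out-degrees. If every out-degree were
  too small, the average of degree plus one would fall below \<open>card A / \<alpha>\<close>, and
  by convexity Caro--Wei would produce an independent set with more than \<open>\<alpha>\<close>
  vertices.\<close>

lemma exists_large_out_degree:
  fixes \<alpha> :: real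
  assumes "finite A" and "A \<noteq> {}" and "symp E" and "irreflp E" and "\<alpha> > 0"
    and orient: "\<And>u v. R u v \<or> R v u \<longleftrightarrow> E u v" "\<And>u v. \<not> (R u v \<and> R v u)"
    and indep_le: "\<And>I. I \<subseteq> A \<Longrightarrow> indep E I \<Longrightarrow> real (card I) \<le> \<alpha>"
  shows "\<exists>v\<in>A. real (card A) / \<alpha> \<le> 2 * real (card {u\<in>A. R v u}) + 1"
proof (rule ccontr)
  assume "\<not> ?thesis"
  then have small: "2 * real (card {u\<in>A. R v u}) + 1 < real (card A) / \<alpha>" if "v \<in> A" for v
    using that by force
  define c where "c = real (card A) / \<alpha>"
  have "card A > 0" using assms(1,2) by (simp add: card_gt_0_iff)
  then have c: "c > 0" using \<open>\<alpha> > 0\<close> by (simp add: c_def)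
  define d where "d v = real (card {u\<in>A. E v u})" for v
  \<comment> \<open>The arcs inside \<open>A\<close> are counted once by head and once by
    tail.\<close>
  have flip: "(\<Sum>v\<in>A. card {u\<in>A. R u v}) = (\<Sum>v\<in>A. card {u\<in>A. R v u})"
    using sum.swap_restrict[OF assms(1) assms(1), of "\<lambda>_ _. 1::nat" "\<lambda>u v. R u v"] by simp
  have "d v = real (card {u\<in>A. R v u}) + real (card {u\<in>A. R u v})" for v
  proof -
    have "{u\<in>A. E v u} = {u\<in>A. R v u} \<union> {u\<in>A. R u v}"
      using orient(1) by blast
    moreover have "{u\<in>A. R v u} \<inter> {u\<in>A. R u v} = {}"
      using orient(2) by blast
    ultimately show ?thesis
      unfolding d_def using assms(1) by (simp add: card_Un_disjoint)
  qed
  then have "(\<Sum>v\<in>A. d v + 1) =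
      real (\<Sum>v\<in>A. card {u\<in>A. R v u}) + real (\<Sum>v\<in>A. card {u\<in>A. R u v}) + real (card A)"
    by (simp add: sum.distrib)
  also have "\<dots> = (\<Sum>v\<in>A. 2 * real (card {u\<in>A. R v u}) + 1)"
    unfolding flip by (simp add: sum.distrib sum_distrib_left)
  also have "\<dots> < (\<Sum>v\<in>A. c)"
    using small assms(1,2) by (intro sum_strict_mono) (auto simp: c_def)
  finally have S: "(\<Sum>v\<in>A. d v + 1) < real (card A) * c" by simp
  \<comment> \<open>The tangent of \<open>1 / y\<close> at \<open>c\<close> replaces the arithmetic-harmonic mean inequality.\<close>
  have tangent: "2 / c - (d v + 1) / c\<^sup>2 \<le> 1 / (d v + 1)" for v
  proof -
    have y: "d v + 1 > 0" by (simp add: d_def add_nonneg_pos)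
    have "0 \<le> (c - (d v + 1))\<^sup>2 / (c\<^sup>2 * (d v + 1))" using y by simp
    also have "\<dots> = 1 / (d v + 1) - (2 / c - (d v + 1) / c\<^sup>2)"
      using y c by (simp add: field_simps power2_eq_square)
    finally show ?thesis by simp
  qed
  \<comment> \<open>If the \<open>d v + 1\<close> summed to exactly \<open>card A * c\<close>, the
    tangent bounds would add up to \<open>card A / c\<close>, which is \<open>\<alpha>\<close>. The
    strict inequality \<open>S\<close> pushes their sum above \<open>\<alpha>\<close>.\<close>
  have "\<alpha> = real (card A) * c / c\<^sup>2"
    using c \<open>\<alpha> > 0\<close> \<open>card A > 0\<close> by (simp add: c_def field_simps power2_eq_square)
  also have "\<dots> = 2 * real (card A) / c - real (card A) * c / c\<^sup>2"
    using c by (simp add: field_simps power2_eq_square)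
  also have "\<dots> < 2 * real (card A) / c - (\<Sum>v\<in>A. d v + 1) / c\<^sup>2"
    using S c by (intro diff_strict_left_mono divide_strict_right_mono) auto
  also have "\<dots> = (\<Sum>v\<in>A. 2 / c - (d v + 1) / c\<^sup>2)"
    by (simp add: sum_subtractf sum_divide_distrib mult.commute)
  also have "\<dots> \<le> (\<Sum>v\<in>A. 1 / (d v + 1))"
    by (intro sum_mono tangent)
  finally have "\<alpha> < (\<Sum>v\<in>A. 1 / (d v + 1))" .
  moreover obtain I where I: "I \<subseteq> A" "indep E I" "(\<Sum>v\<in>A. 1 / (d v + 1)) \<le> real (card I)"
    using caro_wei[OF assms(1,3,4)] unfolding d_def by blast
  ultimately show False using indep_le[OF I(1,2)] by linarith
qed

text \<open>Induction with the right-hand side as a potential: it is 0 on the empty set, and each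
  removal of a vertex together with what it dominates lowers it by at least 1, which pays for that
  vertex.\<close>

lemma greedy_dominating_set:
  fixes \<alpha> :: real
  assumes "finite A" and "symp E" and "irreflp E" and "\<alpha> > 0"
    and "\<And>u v. R u v \<or> R v u \<longleftrightarrow> E u v" and "\<And>u v. \<not> (R u v \<and> R v u)"
    and "\<And>I. I \<subseteq> A \<Longrightarrow> indep E I \<Longrightarrow> real (card I) \<le> \<alpha>"
  shows "\<exists>S\<subseteq>A. (\<forall>u\<in>A - S. \<exists>v\<in>S. R v u) \<and> real (card S) \<le> 2 * \<alpha> * ln (1 + real (card A) / \<alpha>)"
  using assms(1,7)
proof (induction A rule: finite_psubset_induct)
  case (psubset A)
  show ?case
  proof (cases "A = {}")
    case True
    then show ?thesis by auto
  next
    case False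
    obtain v where v: "v \<in> A" "real (card A) / \<alpha> \<le> 2 * real (card {u\<in>A. R v u}) + 1"
      using exists_large_out_degree[OF psubset.hyps(1) False assms(2-6) psubset.prems] by blast
    define N where "N = insert v {u\<in>A. R v u}"
    define B where "B = A - N"
    have "\<not> R v v" using assms(6) by blast
    then have N: "N \<subseteq> A" "finite N" "card N = card {u\<in>A. R v u} + 1"
      using v(1) psubset.hyps(1) by (auto simp: N_def)
    have "B \<subset> A" using v(1) by (auto simp: B_def N_def)
    have "real (card I) \<le> \<alpha>" if "I \<subseteq> B" "indep E I" for I
      using psubset.prems that \<open>B \<subset> A\<close> by (meson psubset_imp_subset subset_trans)
    from psubset.IH[OF \<open>B \<subset> A\<close> this] obtain S where S: "S \<subseteq> B" "\<forall>u\<in>B - S. \<exists>v\<in>S. R v u"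
        "real (card S) \<le> 2 * \<alpha> * ln (1 + real (card B) / \<alpha>)"
      by blast
    define a b where "a = 1 + real (card A) / \<alpha>" and "b = 1 + real (card B) / \<alpha>"
    have pos: "a > 0" "b > 0" using \<open>\<alpha> > 0\<close> by (auto simp: a_def b_def add_pos_nonneg)
    have "card A = card B + card N"
      using N(1,2) psubset.hyps(1) card_mono[OF psubset.hyps(1) N(1)]
      by (simp add: B_def card_Diff_subset)
    then have "a - b = real (card N) / \<alpha>"
      by (simp add: a_def b_def add_divide_distrib)
    \<comment> \<open>The out-degree bound reads \<open>a - 1 \<le> 2 * (card N - 1) + 1\<close>,
      because \<open>N\<close> also counts \<open>v\<close>. The summand 1 in \<open>a\<close>
      absorbs the remainder exactly.\<close>
    moreover have "a \<le> 2 * real (card N)"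
      using v(2) N(3) by (simp add: a_def)
    ultimately have drop: "a \<le> 2 * \<alpha> * (a - b)"
      using \<open>\<alpha> > 0\<close> by simp
    \<comment> \<open>\<open>drop\<close> says that the relative decrease \<open>1 - b / a\<close>
      is at least \<open>1 / (2 * \<alpha>)\<close>; the bound \<open>ln y \<le> y - 1\<close> turns
      this into a decrease of the logarithm.\<close>
    have "ln (b / a) \<le> b / a - 1" using pos by (intro ln_le_minus_one) simp
    then have "1 - b / a \<le> ln a - ln b" using pos by (simp add: ln_div)
    then have "2 * \<alpha> * (1 - b / a) \<le> 2 * \<alpha> * (ln a - ln b)"
      using \<open>\<alpha> > 0\<close> by (intro mult_left_mono) auto
    moreover have "1 \<le> 2 * \<alpha> * (1 - b / a)"
      using drop pos by (simp add: field_simps)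
    ultimately have step: "1 + 2 * \<alpha> * ln b \<le> 2 * \<alpha> * ln a"
      by (simp add: right_diff_distrib)
    have "finite S" using S(1) \<open>B \<subset> A\<close> psubset.hyps(1) by (meson finite_subset psubset_imp_subset)
    then have "card (insert v S) \<le> card S + 1" by (simp add: card_insert_if)
    then have "real (card (insert v S)) \<le> real (card S) + 1" by linarith
    then have "real (card (insert v S)) \<le> 2 * \<alpha> * ln (1 + real (card A) / \<alpha>)"
      using S(3) step unfolding a_def b_def by linarith
    moreover have "\<forall>u\<in>A - insert v S. \<exists>w\<in>insert v S. R w u"
      using S(2) by (auto simp: B_def N_def)
    ultimately show ?thesis
      using S(1) v(1) \<open>B \<subset> A\<close> by (intro exI[of _ "insert v S"]) auto
  qed
qed

section \<open>Independent sets in graphs without induced stars\<close>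

lemma (in graph) out_degree_eq_card_neighbours:
  "out_degree G v = card {u. v \<rightarrow>\<^bsub>G\<^esub> u}"
proof -
  have "inj_on (head G) (out_arcs G v)"
    by (rule inj_onI) (auto intro: no_multi_arcs simp: arc_to_ends_def)
  moreover have "head G ` out_arcs G v = {u. v \<rightarrow>\<^bsub>G\<^esub> u}"
    by (auto simp: arcs_ends_conv image_iff)
  ultimately show ?thesis
    unfolding out_degree_def by (metis card_image)
qed

text \<open>Any \<open>m\<close> neighbours of \<open>v\<close> in \<open>I\<close> are pairwise
  nonadjacent, so together with \<open>v\<close> they would induce a star with centre
  \<open>v\<close>.\<close>

lemma (in graph) star_free_neighbours_in_indep:
  assumes "star_free m G" and "indep (dominates G) I" and "v \<in> verts G"
  shows "card {u\<in>I. v \<rightarrow>\<^bsub>G\<^esub> u} < m"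
proof (rule ccontr)
  assume "\<not> ?thesis"
  then obtain M where M: "M \<subseteq> {u\<in>I. v \<rightarrow>\<^bsub>G\<^esub> u}" "card M = m"
    by (meson leI obtain_subset_with_card_n)
  define H where "H = G \<restriction> (insert v M)"
  have verts: "insert v M \<subseteq> verts G" using M(1) assms(3) adj_in_verts by blast
  have ind: "induced_subgraph H G" unfolding H_def by (rule induced_induce[OF verts])
  have "v \<notin> M" using M(1) adj_not_same by blast
  have "arcs_ends H = {(x, y). x \<rightarrow>\<^bsub>G\<^esub> y \<and> x \<in> insert v M \<and> y \<in> insert v M}"
    by (auto simp: H_def arcs_ends_conv)
  also have "\<dots> = {v} \<times> M \<union> M \<times> {v}"
  proof -
    have "\<not> x \<rightarrow>\<^bsub>G\<^esub> y" if "x \<in> M" "y \<in> M" for x y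
      using that M(1) assms(2) unfolding indep_def by blast
    moreover have "v \<rightarrow>\<^bsub>G\<^esub> x" "x \<rightarrow>\<^bsub>G\<^esub> v" if "x \<in> M" for x
      using that M(1) graph_symmetric by blast+
    moreover have "\<not> v \<rightarrow>\<^bsub>G\<^esub> v" using adj_not_same by blast
    ultimately show ?thesis by auto
  qed
  finally have "arcs_ends H = {v} \<times> M \<union> M \<times> {v}" .
  moreover have "graph H"
    using digraphI_induced[OF ind] induced_graph_imp_symmetric[OF sym_arcs ind]
    by (rule digraph.graphI)
  moreover have "verts H = {v} \<union> M" by (simp add: H_def)
  moreover have "{v} \<inter> M = {}" "card {v} = 1" using \<open>v \<notin> M\<close> by auto
  ultimately have "complete_bipartite_digraph 1 m H"
    unfolding complete_bipartite_digraph_def using M(2) by metis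
  then show False using ind assms(1) by (auto simp: star_free_def)
qed

text \<open>Double counting of the edges between \<open>I\<close> and its complement: all edges at a
  vertex of \<open>I\<close> leave \<open>I\<close>, and each outside vertex receives at most
  \<open>m - 1\<close> of them.\<close>

lemma (in graph) card_indep_le_of_star_free:
  assumes "star_free m G" and "indep (dominates G) I" and "I \<subseteq> verts G"
  shows "card I * (min_degree G + (m - 1)) \<le> (m - 1) * card (verts G)"
proof -
  let ?V = "verts G"
  have fin: "finite I" "finite (?V - I)" using finite_subset[OF assms(3)] by auto
  have "card I * min_degree G = (\<Sum>u\<in>I. min_degree G)" by simp
  also have "\<dots> \<le> (\<Sum>u\<in>I. card {v\<in>?V - I. u \<rightarrow>\<^bsub>G\<^esub> v})"
  proof (rule sum_mono)
    fix u assume "u \<in> I"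
    have "min_degree G \<le> out_degree G u"
      unfolding min_degree_def using \<open>u \<in> I\<close> assms(3) by (intro Min_le) auto
    moreover have "{v\<in>?V - I. u \<rightarrow>\<^bsub>G\<^esub> v} = {v. u \<rightarrow>\<^bsub>G\<^esub> v}"
      using \<open>u \<in> I\<close> assms(2) adj_in_verts by (auto simp: indep_def)
    ultimately show "min_degree G \<le> card {v\<in>?V - I. u \<rightarrow>\<^bsub>G\<^esub> v}"
      by (simp add: out_degree_eq_card_neighbours)
  qed
  also have "\<dots> = (\<Sum>v\<in>?V - I. card {u\<in>I. u \<rightarrow>\<^bsub>G\<^esub> v})"
    using sum.swap_restrict[OF fin, of "\<lambda>_ _. 1::nat" "\<lambda>u v. u \<rightarrow>\<^bsub>G\<^esub> v"] by simp
  also have "\<dots> \<le> (\<Sum>v\<in>?V - I. m - 1)"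
  proof (rule sum_mono)
    fix v assume "v \<in> ?V - I"
    then have "card {u\<in>I. v \<rightarrow>\<^bsub>G\<^esub> u} < m"
      using star_free_neighbours_in_indep assms(1,2) by blast
    moreover have "{u\<in>I. v \<rightarrow>\<^bsub>G\<^esub> u} = {u\<in>I. u \<rightarrow>\<^bsub>G\<^esub> v}"
      using graph_symmetric by blast
    ultimately show "card {u\<in>I. u \<rightarrow>\<^bsub>G\<^esub> v} \<le> m - 1" by simp
  qed
  also have "\<dots> = (m - 1) * (card ?V - card I)"
    using assms(3) fin by (simp add: card_Diff_subset)
  \<comment> \<open>Adding \<open>(m - 1) * card I\<close> to both sides removes the truncated
    subtraction.\<close>
  finally have "card I * min_degree G + (m - 1) * card I
      \<le> (m - 1) * (card ?V - card I) + (m - 1) * card I" by simp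
  also have "\<dots> = (m - 1) * card ?V"
    using card_mono[OF finite_verts assms(3)] by (simp flip: distrib_left)
  finally show ?thesis by (simp add: algebra_simps)
qed

section \<open>Bounds on the directed domination number\<close>

text \<open>The greedy bound applies with adjacency in \<open>G\<close> as \<open>E\<close> and the
  arcs of \<open>D\<close> as \<open>R\<close>: being an orientation provides both conditions that
  relate \<open>R\<close> to \<open>E\<close>.\<close>

lemma (in graph) dir_domination_number_le_of_indep_le:
  fixes \<alpha> :: real
  assumes "orientation D G" and "\<alpha> > 0"
    and "\<And>I. I \<subseteq> verts G \<Longrightarrow> indep (dominates G) I \<Longrightarrow> real (card I) \<le> \<alpha>"
  shows "real (dir_domination_number D) \<le> 2 * \<alpha> * ln (1 + real (card (verts G)) / \<alpha>)"
proof -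
  have D: "verts D = verts G" "\<And>u v. u \<rightarrow>\<^bsub>D\<^esub> v \<Longrightarrow> u \<rightarrow>\<^bsub>G\<^esub> v"
    "\<And>u v. u \<rightarrow>\<^bsub>G\<^esub> v \<Longrightarrow> (u \<rightarrow>\<^bsub>D\<^esub> v \<longleftrightarrow> \<not> v \<rightarrow>\<^bsub>D\<^esub> u)"
    using assms(1) by (auto simp: orientation_def spanning_def subgraph_def compatible_def arcs_ends_conv)
  have "symp (dominates G)" "irreflp (dominates G)"
    using graph_symmetric adj_not_same by (auto simp: symp_def irreflp_def)
  moreover have "u \<rightarrow>\<^bsub>D\<^esub> v \<or> v \<rightarrow>\<^bsub>D\<^esub> u \<longleftrightarrow> u \<rightarrow>\<^bsub>G\<^esub> v" "\<not> (u \<rightarrow>\<^bsub>D\<^esub> v \<and> v \<rightarrow>\<^bsub>D\<^esub> u)" for u v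
    using D(2,3) graph_symmetric by blast+
  ultimately obtain S where "S \<subseteq> verts G" "\<forall>u\<in>verts G - S. \<exists>v\<in>S. v \<rightarrow>\<^bsub>D\<^esub> u"
      "real (card S) \<le> 2 * \<alpha> * ln (1 + real (card (verts G)) / \<alpha>)"
    using greedy_dominating_set[OF finite_verts, of "dominates G" \<alpha> "dominates D"] assms(2,3) by blast
  moreover from this have "dir_domination_number D \<le> card S"
    unfolding dir_domination_number_def
    by (intro Min_le finite_imageI finite_dir_dominating imageI) (auto simp: dir_dominating_def D(1))
  ultimately show ?thesis by linarith
qed

theorem theorem2p9:
  fixes G :: "('a, 'b) pre_digraph" and m n \<delta> :: nat
  assumes "m \<ge> 3"
    and "graph G"
    and "verts G \<noteq> {}"
    and "star_free m G"
    and "card (verts G) = n"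
    and "min_degree G = \<delta>"
  shows "real (upper_dir_domination_number G) <
    2 * (real m - 1) * real n * ln (real \<delta> + real m - 1) / (real \<delta> + real m - 1)"
proof -
  interpret graph G by fact
  \<comment> \<open>The maximum is attained, so it suffices to bound one orientation.\<close>
  have "upper_dir_domination_number G \<in> dir_domination_number ` {D. orientation D G}"
    unfolding upper_dir_domination_number_def
    using finite_orientations[OF fin_digraph] orientation_exists[OF assms(2)]
    by (intro Max_in) auto
  then obtain D where D: "orientation D G"
    "upper_dir_domination_number G = dir_domination_number D" by blast
  have "n > 0" using assms(3,5) by (auto simp: card_gt_0_iff)
  define k x where "k = real m - 1" and "x = real \<delta> + real m - 1"
  have k: "k \<ge> 2" "k \<le> x" using assms(1) by (auto simp: k_def x_def)
  have "real (dir_domination_number D) < 2 * k * real n * ln x / x"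
  proof (cases "\<delta> = 0")
    case True
    have vD: "verts D = verts G" using D(1) by (simp add: orientation_def spanning_def)
    have "dir_domination_number D \<le> card (verts D)"
      unfolding dir_domination_number_def
      by (intro Min_le finite_imageI finite_dir_dominating imageI) (use dir_dominating_verts[of D] vD in auto)
    then have "real (dir_domination_number D) \<le> real n" using vD assms(5) by simp
    \<comment> \<open>Since \<open>x \<ge> 2\<close>, it is enough that
      \<open>2 * ln 2 = ln 4\<close> exceeds 1, which follows from
      \<open>exp 1 \<le> 3\<close>.\<close>
    also have "real n < real n * (2 * ln x)"
    proof -
      have "ln 2 \<le> ln x" using k by simp
      moreover have "1 < 2 * ln (2::real)"
      proof -
        have "exp 1 < (2::real)\<^sup>2" using exp_le by simp
        then have "ln (exp 1) < ln ((2::real)\<^sup>2)" by (subst ln_less_cancel_iff) auto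
        then show ?thesis unfolding ln_realpow by simp
      qed
      ultimately have "1 < 2 * ln x" by linarith
      then show ?thesis using \<open>n > 0\<close> by simp
    qed
    also have "\<dots> = 2 * k * real n * ln x / x"
    proof -
      have "x = k" using True by (simp add: k_def x_def)
      then show ?thesis using k by simp
    qed
    finally show ?thesis .
  next
    case False
    define \<alpha> where "\<alpha> = k * real n / x"
    have "\<alpha> > 0" using k \<open>n > 0\<close> by (simp add: \<alpha>_def)
    have "real (card I) \<le> \<alpha>" if "I \<subseteq> verts G" "indep (dominates G) I" for I
    proof -
      have "card I * (\<delta> + (m - 1)) \<le> (m - 1) * n"
        using card_indep_le_of_star_free[OF assms(4) that(2,1)] unfolding assms(5,6) .
      then have "real (card I * (\<delta> + (m - 1))) \<le> real ((m - 1) * n)"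
        by (simp only: of_nat_le_iff)
      then have "real (card I) * x \<le> k * real n"
        using assms(1) by (simp add: k_def x_def of_nat_diff add_diff_eq)
      then show ?thesis using k by (simp add: \<alpha>_def field_simps)
    qed
    from dir_domination_number_le_of_indep_le[OF D(1) \<open>\<alpha> > 0\<close> this]
    have "real (dir_domination_number D) \<le> 2 * \<alpha> * ln (1 + real n / \<alpha>)"
      using assms(5) by simp
    also have "\<dots> < 2 * \<alpha> * ln x"
    proof -
      \<comment> \<open>The comparison of logarithms needs \<open>1 + x / k < x\<close>, that is,
        \<open>(x - 1) * (k - 1) > 1\<close>. With \<open>\<delta> > 0\<close> the product is at
        least 2; for \<open>\<delta> = 0\<close> and \<open>m = 3\<close> it would be exactly
        1.\<close>
      have "x \<ge> 3" using False assms(1) by (simp add: x_def)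
      then have "(x - 1) * (k - 1) \<ge> 2 * 1" using k by (intro mult_mono) auto
      then have "1 + x / k < x" using k by (simp add: field_simps)
      moreover have "real n / \<alpha> = x / k" using \<open>n > 0\<close> by (simp add: \<alpha>_def)
      ultimately have "ln (1 + real n / \<alpha>) < ln x"
        using k by (intro ln_less_cancel_iff[THEN iffD2]) (auto simp: add_pos_pos)
      then show ?thesis using \<open>\<alpha> > 0\<close> by simp
    qed
    also have "\<dots> = 2 * k * real n * ln x / x" by (simp add: \<alpha>_def)
    finally show ?thesis .
  qed
  then show ?thesis unfolding D(2) k_def x_def .
qed

end
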